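(* Let $\pi_1,\pi_2,\pi_3,\pi_4$ be $4$-point permutations such that $A_{\pi_1}+A_{\pi_2}+A_{\pi_3}+A_{\pi_4}$ is the $4\times4$ all-one matrix, and suppose the quadruple is neither $1234,2143,3412,4321$ nor $1324,2413,3142,4231$. Then $\{\pi_1,\pi_2,\pi_3,\pi_4\}$ is not quasirandom-forcing.
   Context: A $4$-point permutation $\pi$ is written $\pi(1)\pi(2)\pi(3)\pi(4)$; $A_\pi$ is the $4\times4$ matrix with entry $1$ in row $i$ and column $\pi(i)$ for each $i$ and $0$ elsewhere. Pattern density $d(\sigma,\pi)$: probability that a uniformly random $|\sigma|$-subset $\{a_1<\dots<a_{|\sigma|}\}$ of positions of $\pi$ satisfies $\pi(a_i)<\pi(a_j)\iff\sigma(i)<\sigma(j)$. A set $S$ of permutations is quasirandom-forcing if every sequence of permutations with sizes tending to infinity and $d(\sigma,\pi_n)\to1/|\sigma|!$ for all $\sigma\in S$ has $d(\sigma,\pi_n)\to1/|\sigma|!$ for all permutations $\sigma$. *)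

theory Defs
  imports Complex_Main "HOL-Combinatorics.Multiset_Permutations" "Jordan_Normal_Form.Matrix"
begin

text \<open>
  A permutation of size n is represented by its one-line notation, a list that arranges
  the set {1..n}. Values are 1-based, list positions and matrix indices are 0-based.
\<close>

definition is_perm :: "nat list \<Rightarrow> bool" where
  "is_perm \<pi> \<longleftrightarrow> \<pi> \<in> permutations_of_set {1..length \<pi>}"

definition perm_matrix :: "nat list \<Rightarrow> int mat" where
  "perm_matrix \<pi> = mat (length \<pi>) (length \<pi>) (\<lambda>(i, j). if \<pi> ! i = j + 1 then 1 else 0)"

definition occurs_at :: "nat list \<Rightarrow> nat list \<Rightarrow> nat set \<Rightarrow> bool" where
  "occurs_at \<sigma> \<pi> A \<longleftrightarrow>
     (let a = sorted_list_of_set A in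
      \<forall>i < length \<sigma>. \<forall>j < length \<sigma>. \<pi> ! (a ! i) < \<pi> ! (a ! j) \<longleftrightarrow> \<sigma> ! i < \<sigma> ! j)"

text \<open>
  The probability is the quotient of favourable by all subsets of the right size; it is
  0 by convention (division by zero) if the pattern is longer than the permutation.
\<close>

definition pattern_density :: "nat list \<Rightarrow> nat list \<Rightarrow> real" where
  "pattern_density \<sigma> \<pi> =
     real (card {A. A \<subseteq> {..<length \<pi>} \<and> card A = length \<sigma> \<and> occurs_at \<sigma> \<pi> A}) /
     real (card {A. A \<subseteq> {..<length \<pi>} \<and> card A = length \<sigma>})"

definition quasirandom_forcing :: "nat list set \<Rightarrow> bool" where
  "quasirandom_forcing S \<longleftrightarrow>
     (\<forall>P :: nat \<Rightarrow> nat list.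
        (\<forall>n. is_perm (P n)) \<longrightarrow>
        filterlim (\<lambda>n. length (P n)) at_top sequentially \<longrightarrow>
        (\<forall>\<sigma>\<in>S. (\<lambda>n. pattern_density \<sigma> (P n)) \<longlonglongrightarrow> 1 / fact (length \<sigma>)) \<longrightarrow>
        (\<forall>\<sigma>. is_perm \<sigma> \<longrightarrow>
           (\<lambda>n. pattern_density \<sigma> (P n)) \<longlonglongrightarrow> 1 / fact (length \<sigma>)))"

end

theory Submission
  imports Defs
begin

text \<open>
  Replace every point of a permutation of size k by an increasing or a decreasing run of
  length n. The order of a tuple of positions of the resulting permutation of size k n is
  determined by the blocks it meets, so as n grows the density of a pattern of length m
  converges to N / k^m for an explicitly computable integer N. A choice of points and of
  directions of runs for which this limit is 1/4! at the four given patterns, but is not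
  1/3! at the pattern 123, refutes quasirandom-forcing. The quadruples in question are the 24
  decompositions of the all-one matrix, that is the 4 x 4 Latin squares up to renaming of the
  symbols, and for each of the 22 that are not excluded there is a suitable permutation of
  size 12.
\<close>

section \<open>Signed permutations and the block sequences of a pattern\<close>

text \<open>
  A permutation with directions of runs is a list of integers: the absolute values are the
  one-line notation, and a point is inflated to an increasing run iff its entry is positive.
\<close>

definition ascends :: "int list \<Rightarrow> nat \<Rightarrow> nat \<Rightarrow> bool" where
  "ascends t i j \<longleftrightarrow> (if i = j then 0 < t ! i else \<bar>t ! i\<bar> < \<bar>t ! j\<bar>)"

text \<open>Enumerates the weakly increasing block sequences that carry occurrences of the pattern.
  Growing them from the right and testing each new head at once prunes the search, which keeps
  evaluation feasible.\<close>

fun embeddings :: "int list \<Rightarrow> nat list \<Rightarrow> nat list list" where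
  "embeddings t [] = [[]]"
| "embeddings t (s # \<sigma>) =
     [i # b. b \<leftarrow> embeddings t \<sigma>,
        i \<leftarrow> filter (\<lambda>i. list_all2 (\<lambda>s' j. i \<le> j \<and> (s < s' \<longleftrightarrow> ascends t i j)) \<sigma> b) [0..<length t]]"

lemma set_embeddings:
  "b \<in> set (embeddings t \<sigma>) \<longleftrightarrow>
     length b = length \<sigma> \<and> set b \<subseteq> {..<length t} \<and>
     (\<forall>j<length \<sigma>. \<forall>i<j. b ! i \<le> b ! j \<and> (\<sigma> ! i < \<sigma> ! j \<longleftrightarrow> ascends t (b ! i) (b ! j)))"
proof (induction \<sigma> arbitrary: b)
  case Nil
  then show ?case by auto
next
  case (Cons s \<sigma>)
  show ?case
  proof (cases b)
    case Nil
    then show ?thesis by auto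
  next
    case (Cons i c)
    have *: "b \<in> set (embeddings t (s # \<sigma>)) \<longleftrightarrow> c \<in> set (embeddings t \<sigma>) \<and> i < length t \<and>
        list_all2 (\<lambda>s' j. i \<le> j \<and> (s < s' \<longleftrightarrow> ascends t i j)) \<sigma> c"
      by (auto simp: Cons)
    \<comment> \<open>Pairs \<open>i < j\<close> split by whether \<open>i\<close> is 0: comparisons
      with the new head, as in the filter, and comparisons within the tail, as in the induction
      hypothesis.\<close>
    have "(\<forall>j<Suc m. \<forall>i<j. Q i j) \<longleftrightarrow> (\<forall>j<m. Q 0 (Suc j)) \<and> (\<forall>j<m. \<forall>i<j. Q (Suc i) (Suc j))"
      for m and Q :: "nat \<Rightarrow> nat \<Rightarrow> bool"
      by (auto simp: All_less_Suc2)
    note split = this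
    show ?thesis
      unfolding * Cons.IH list_all2_conv_all_nth unfolding Cons
      unfolding list.size nth_Cons_Suc nth_Cons_0 split add_Suc_right add_0_right
      by auto
  qed
qed

text \<open>Lets the list sum in \<open>embedding_weight\<close> be read as a sum over a
  set.\<close>

lemma distinct_embeddings: "distinct (embeddings t \<sigma>)"
proof (induction \<sigma>)
  case (Cons s \<sigma>)
  have "distinct (concat (map (\<lambda>b. map (\<lambda>i. i # b) (filter (P b) [0..<k])) bs))"
    if "distinct bs" for P k and bs :: "nat list list"
    using that by (induction bs) (auto simp: distinct_map inj_on_def)
  from this[OF Cons.IH] show ?case by simp
qed auto

section \<open>Inflations of signed permutations\<close>

text \<open>Both offsets range over 1..n, so values are 1-based and different blocks occupy disjoint
  intervals of values.\<close>

definition inflate :: "int list \<Rightarrow> nat \<Rightarrow> nat list" where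
  "inflate t n = map (\<lambda>x. (nat \<bar>t ! (x div n)\<bar> - 1) * n +
      (if 0 < t ! (x div n) then x mod n + 1 else n - x mod n)) [0..<length t * n]"

lemma length_inflate [simp]: "length (inflate t n) = length t * n"
  by (simp add: inflate_def)

text \<open>One executable equation for distinctness and range; it also excludes 0, so every entry
  has a sign.\<close>

definition is_signed_perm :: "int list \<Rightarrow> bool" where
  "is_signed_perm t \<longleftrightarrow> sort (map (\<lambda>x. nat \<bar>x\<bar>) t) = [1..<Suc (length t)]"

lemma signed_permD:
  assumes "is_signed_perm t"
  shows "distinct (map (\<lambda>x. nat \<bar>x\<bar>) t)" "set (map (\<lambda>x. nat \<bar>x\<bar>) t) = {1..length t}"
proof -
  have *: "mset (map (\<lambda>x. nat \<bar>x\<bar>) t) = mset [1..<Suc (length t)]"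
    using assms unfolding is_signed_perm_def by (metis mset_sort)
  show "distinct (map (\<lambda>x. nat \<bar>x\<bar>) t)"
    using mset_eq_imp_distinct_iff[OF *] distinct_upt by blast
  show "set (map (\<lambda>x. nat \<bar>x\<bar>) t) = {1..length t}"
    using mset_eq_setD[OF *] by (simp only: set_upt atLeastLessThanSuc_atLeastAtMost)
qed

lemma signed_perm_nth:
  assumes "is_signed_perm t" "i < length t"
  shows "1 \<le> nat \<bar>t ! i\<bar>" "nat \<bar>t ! i\<bar> \<le> length t"
proof -
  have "map (\<lambda>x. nat \<bar>x\<bar>) t ! i \<in> set (map (\<lambda>x. nat \<bar>x\<bar>) t)"
    using assms(2) by (metis length_map nth_mem)
  also have "\<dots> = {1..length t}"
    by (rule signed_permD(2)[OF assms(1)])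
  finally show "1 \<le> nat \<bar>t ! i\<bar>" "nat \<bar>t ! i\<bar> \<le> length t"
    using assms(2) by auto
qed

lemma signed_perm_inj:
  assumes "is_signed_perm t" "i < length t" "j < length t" "nat \<bar>t ! i\<bar> = nat \<bar>t ! j\<bar>"
  shows "i = j"
  using assms nth_eq_iff_index_eq[OF signed_permD(1)[OF assms(1)], of i j] by simp

text \<open>Between blocks only the order of their value intervals matters; within a block the run
  is strictly monotone in the direction given by the sign.\<close>

lemma inflate_less_iff:
  assumes t: "is_signed_perm t" and xy: "x < y" "y < length t * n"
  shows "inflate t n ! x < inflate t n ! y \<longleftrightarrow> ascends t (x div n) (y div n)"
    and "inflate t n ! x \<noteq> inflate t n ! y"
proof -
  define v where "v i = nat \<bar>t ! i\<bar> - 1" for i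
  define r where "r x = (if 0 < t ! (x div n) then x mod n + 1 else n - x mod n)" for x
  have n: "n > 0" using xy by (cases n) auto
  have nth: "inflate t n ! z = v (z div n) * n + r z" if "z \<le> y" for z
    using that xy by (simp add: inflate_def v_def r_def)
  have r: "1 \<le> r z" "r z \<le> n" for z
    using n mod_less_divisor[of n z] by (auto simp: r_def simp del: mod_less_divisor)
  have lt: "x div n < length t" "y div n < length t"
    using xy by (auto simp: less_mult_imp_div_less)
  \<comment> \<open>Offsets lie in 1..n, so a block of smaller value stays entirely below one of
    larger value.\<close>
  have v_less: "v i * n + r z < v j * n + r w" if "v i < v j" for i j z w
  proof -
    have "v i * n + r z < (v i + 1) * n + r w" using r[of z] r[of w] by simp
    also have "\<dots> \<le> v j * n + r w" using that by (intro add_right_mono mult_right_mono) auto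
    finally show ?thesis .
  qed
  have main: "(inflate t n ! x < inflate t n ! y \<longleftrightarrow> ascends t (x div n) (y div n)) \<and>
     inflate t n ! x \<noteq> inflate t n ! y"
  proof (cases "x div n = y div n")
    case True
    then have "x mod n < y mod n"
      using xy by (metis div_mult_mod_eq nat_add_left_cancel_less)
    moreover have "y mod n < n" using n by simp
    ultimately show ?thesis
      using True xy by (auto simp: nth r_def ascends_def)
  next
    case False
    then have ne: "nat \<bar>t ! (x div n)\<bar> \<noteq> nat \<bar>t ! (y div n)\<bar>"
      using signed_perm_inj[OF t lt] by auto
    have "ascends t (x div n) (y div n) \<longleftrightarrow> nat \<bar>t ! (x div n)\<bar> < nat \<bar>t ! (y div n)\<bar>"
      using False by (simp add: ascends_def nat_less_eq_zless del: zless_nat_conj)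
    \<comment> \<open>Entries have absolute value at least 1, so the truncated subtraction in
      \<open>v\<close> preserves the strict order.\<close>
    then have a: "ascends t (x div n) (y div n) \<longleftrightarrow> v (x div n) < v (y div n)"
      using signed_perm_nth(1)[OF t lt(1)] signed_perm_nth(1)[OF t lt(2)]
      unfolding v_def by linarith
    have "v (x div n) < v (y div n) \<or> v (y div n) < v (x div n)"
      using ne signed_perm_nth(1)[OF t lt(1)] signed_perm_nth(1)[OF t lt(2)]
      unfolding v_def by linarith
    then show ?thesis
    proof
      assume "v (x div n) < v (y div n)"
      with v_less[OF this, of x y] show ?thesis
        using a nth[OF less_imp_le[OF xy(1)]] nth[OF order.refl] by simp
    next
      assume "v (y div n) < v (x div n)"
      with v_less[OF this, of y x] show ?thesis
        using a nth[OF less_imp_le[OF xy(1)]] nth[OF order.refl] by simp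
    qed
  qed
  then show "inflate t n ! x < inflate t n ! y \<longleftrightarrow> ascends t (x div n) (y div n)"
    and "inflate t n ! x \<noteq> inflate t n ! y" by auto
qed

text \<open>Injectivity comes from \<open>inflate_less_iff\<close>; the values lie in a set of the
  same size as the list, so they fill it.\<close>

lemma is_perm_inflate:
  assumes t: "is_signed_perm t"
  shows "is_perm (inflate t n)"
proof -
  have d: "distinct (inflate t n)"
  proof (unfold distinct_conv_nth, intro allI impI)
    fix i j assume "i < length (inflate t n)" "j < length (inflate t n)" "i \<noteq> j"
    then show "inflate t n ! i \<noteq> inflate t n ! j"
      using inflate_less_iff(2)[OF t, of i j n] inflate_less_iff(2)[OF t, of j i n]
      by (cases i j rule: linorder_cases) auto
  qed
  have "inflate t n ! x \<in> {1..length t * n}" if x: "x < length t * n" for x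
  proof -
    have n: "n > 0" using x by (cases n) auto
    have "x div n < length t" using x by (simp add: less_mult_imp_div_less)
    from signed_perm_nth[OF t this] have "nat \<bar>t ! (x div n)\<bar> - 1 + 1 \<le> length t" by simp
    then have "(nat \<bar>t ! (x div n)\<bar> - 1 + 1) * n \<le> length t * n" by (rule mult_right_mono) simp
    moreover have "x mod n < n" using n by simp
    ultimately show ?thesis using x by (auto simp: inflate_def)
  qed
  then have "set (inflate t n) \<subseteq> {1..length t * n}" by (auto simp: in_set_conv_nth)
  moreover have "card (set (inflate t n)) = card {1..length t * n}"
    using distinct_card[OF d] by simp
  ultimately have "set (inflate t n) = {1..length t * n}" by (intro card_subset_eq) auto
  then show ?thesis using d by (simp add: is_perm_def permutations_of_set_def)
qed

section \<open>Exact pattern densities of inflations\<close>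

text \<open>By \<open>inflate_less_iff\<close> every comparison of values depends only on the blocks
  of the two positions.\<close>

lemma occurs_at_inflate_iff:
  assumes t: "is_signed_perm t" and \<sigma>: "distinct \<sigma>"
    and A: "A \<subseteq> {..<length t * n}" "card A = length \<sigma>"
  shows "occurs_at \<sigma> (inflate t n) A \<longleftrightarrow>
    map (\<lambda>x. x div n) (sorted_list_of_set A) \<in> set (embeddings t \<sigma>)"
proof -
  define a where "a = sorted_list_of_set A"
  have fin: "finite A" using A(1) finite_subset by blast
  have la: "length a = length \<sigma>" and sa: "set a = A" using A(2) fin by (simp_all add: a_def)
  have less: "a ! i < a ! j" if "i < j" "j < length \<sigma>" for i j
    using that la fin strict_sorted_list_of_set[of A] by (simp add: a_def sorted_wrt_iff_nth_less)
  have bound: "a ! i < length t * n" if "i < length \<sigma>" for i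
    using that la sa A(1) nth_mem[of i a] by auto
  let ?p = "inflate t n" and ?b = "map (\<lambda>x. x div n) a"
  have sub: "set ?b \<subseteq> {..<length t}"
    using sa A(1) by (auto simp: less_mult_imp_div_less)
  have asc: "?p ! (a ! i) < ?p ! (a ! j) \<longleftrightarrow> ascends t (?b ! i) (?b ! j)"
    "?p ! (a ! i) \<noteq> ?p ! (a ! j)" "?b ! i \<le> ?b ! j"
    if "i < j" "j < length \<sigma>" for i j
    using inflate_less_iff[OF t less[OF that] bound[OF that(2)]] that la less[OF that]
    by (auto simp: div_le_mono)
  have ne: "\<sigma> ! i \<noteq> \<sigma> ! j" if "i < j" "j < length \<sigma>" for i j
    using \<sigma> that by (simp add: nth_eq_iff_index_eq)
  \<comment> \<open>\<open>occurs_at\<close> compares all ordered pairs, \<open>embeddings\<close>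
    only those with \<open>i < j\<close>. The values are distinct on both sides, so the reversed
    comparisons follow by negation.\<close>
  have "occurs_at \<sigma> ?p A \<longleftrightarrow>
     (\<forall>j<length \<sigma>. \<forall>i<j. ?p ! (a ! i) < ?p ! (a ! j) \<longleftrightarrow> \<sigma> ! i < \<sigma> ! j)" (is "?L \<longleftrightarrow> ?R")
  proof
    assume ?L then show ?R by (auto simp: occurs_at_def a_def Let_def)
  next
    assume R: ?R
    have "?p ! (a ! i) < ?p ! (a ! j) \<longleftrightarrow> \<sigma> ! i < \<sigma> ! j" if ij: "i < length \<sigma>" "j < length \<sigma>" for i j
    proof (cases i j rule: linorder_cases)
      case less then show ?thesis using R ij by auto
    next
      case greater
      then show ?thesis using R ij asc(2)[of j i] ne[of j i] by (metis not_less_iff_gr_or_eq)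
    qed auto
    then show ?L by (simp add: occurs_at_def a_def Let_def)
  qed
  also have "\<dots> \<longleftrightarrow> ?b \<in> set (embeddings t \<sigma>)"
    unfolding set_embeddings using sub la asc by auto
  finally show ?thesis by (simp add: a_def)
qed

text \<open>A sorted list is determined by its multiset, hence by its multiplicities.\<close>

lemma map_div_sorted_list_of_set_eq_iff:
  fixes k n :: nat
  assumes A: "A \<subseteq> {..<k * n}" and b: "sorted b" "set b \<subseteq> {..<k}"
  shows "map (\<lambda>x. x div n) (sorted_list_of_set A) = b \<longleftrightarrow>
    (\<forall>i<k. card {x \<in> A. x div n = i} = count_list b i)"
proof -
  let ?c = "map (\<lambda>x. x div n) (sorted_list_of_set A)"
  have fin: "finite A" by (rule finite_subset[OF A]) simp
  have count: "count_list ?c i = card {x \<in> A. x div n = i}" for i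
  proof -
    have "count_list ?c i = length (filter (\<lambda>x. i = x div n) (sorted_list_of_set A))"
      by (simp add: count_list_eq_length_filter filter_map comp_def)
    also have "\<dots> = card (set (filter (\<lambda>x. i = x div n) (sorted_list_of_set A)))"
      by (rule distinct_card[symmetric]) simp
    also have "set (filter (\<lambda>x. i = x div n) (sorted_list_of_set A)) = {x \<in> A. x div n = i}"
      using fin by auto
    finally show ?thesis .
  qed
  have sub: "set ?c \<subseteq> {..<k}" using A fin by (auto simp: less_mult_imp_div_less)
  have "sorted ?c"
    using sorted_sorted_list_of_set[of A] unfolding sorted_map
    by (rule sorted_wrt_mono_rel[rotated]) (auto simp: div_le_mono)
  then have "?c = b \<longleftrightarrow> mset ?c = mset b"
    using b(1) by (metis properties_for_sort sort_key_id_if_sorted)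
  also have "\<dots> \<longleftrightarrow> (\<forall>i. count_list ?c i = count_list b i)"
    by (simp only: multiset_eq_iff count_mset)
  also have "\<dots> \<longleftrightarrow> (\<forall>i<k. count_list ?c i = count_list b i)"
    using sub b(2) by (metis count_notin lessThan_iff subset_iff)
  finally show ?thesis by (simp add: count)
qed

text \<open>The parts of the set in the different blocks can be chosen independently, and
  \<open>b\<close> prescribes only their sizes.\<close>

lemma card_subsets_with_blocks:
  assumes n: "n > 0" and b: "sorted b" "set b \<subseteq> {..<k}"
  shows "card {A. A \<subseteq> {..<k * n} \<and> map (\<lambda>x. x div n) (sorted_list_of_set A) = b} =
    (\<Prod>i<k. n choose count_list b i)"
proof -
  define B where "B i = {x. x div n = i}" for i
  \<comment> \<open>Positivity of \<open>n\<close> matters: division by 0 would put every position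
    into block 0.\<close>
  have B: "B i = {n * i..<n * i + n}" for i
    using n by (auto simp: B_def div_nat_eqI algebra_simps dividend_less_times_div)
  have disj: "i = j" if "x \<in> B i" "x \<in> B j" for x i j
    using that by (auto simp: B_def)
  have sub: "B i \<subseteq> {..<k * n}" if "i < k" for i
  proof -
    have "Suc i * n \<le> k * n" using that by (intro mult_right_mono) auto
    then show ?thesis by (auto simp: B algebra_simps)
  qed
  let ?F = "\<Pi>\<^sub>E i\<in>{..<k}. {X. X \<subseteq> B i \<and> card X = count_list b i}"
  \<comment> \<open>Cutting a set along the blocks is inverted by uniting the pieces; the four goals
    are the two inverse laws and then the two inclusions.\<close>
  have "bij_betw (\<lambda>A. \<lambda>i\<in>{..<k}. A \<inter> B i)
     {A. A \<subseteq> {..<k * n} \<and> (\<forall>i<k. card {x \<in> A. x div n = i} = count_list b i)} ?F"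
  proof (rule bij_betw_byWitness[where f' = "\<lambda>f. \<Union>i<k. f i"], goal_cases)
    case 1
    show ?case
    proof safe
      fix A x assume "A \<subseteq> {..<k * n}" "x \<in> A"
      then have "x div n < k" by (auto intro: less_mult_imp_div_less)
      with \<open>x \<in> A\<close> show "x \<in> (\<Union>i<k. (\<lambda>i\<in>{..<k}. A \<inter> B i) i)" by (auto simp: B_def)
    qed auto
  next
    case 2
    show ?case
    proof safe
      fix f assume f: "f \<in> ?F"
      show "(\<lambda>i\<in>{..<k}. (\<Union>i<k. f i) \<inter> B i) = f"
      proof
        fix i show "(\<lambda>i\<in>{..<k}. (\<Union>i<k. f i) \<inter> B i) i = f i"
        proof (cases "i < k")
          case True
          have "f j \<subseteq> B j" if "j < k" for j using PiE_mem[OF f, of j] that by auto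
          with True disj have "(\<Union>i<k. f i) \<inter> B i = f i" by blast
          with True show ?thesis by simp
        next
          case False
          with f show ?thesis by (simp add: PiE_arb[OF f])
        qed
      qed
    qed
  next
    case 3
    show ?case by (auto simp: B_def Int_def)
  next
    case 4
    show ?case
    proof safe
      fix f x i assume f: "f \<in> ?F" and i: "i < k" and x: "x \<in> f i"
      have "f i \<subseteq> B i" using PiE_mem[OF f, of i] i by auto
      then show "x < k * n" using sub[OF i] x by auto
    next
      fix f i assume f: "f \<in> ?F" and i: "i < k"
      have "f j \<subseteq> B j" if "j < k" for j using PiE_mem[OF f, of j] that by auto
      then have "{x \<in> \<Union> (f ` {..<k}). x div n = i} = f i"
        using i unfolding B_def by blast
      moreover have "card (f i) = count_list b i" using PiE_mem[OF f, of i] i by auto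
      ultimately show "card {x \<in> \<Union> (f ` {..<k}). x div n = i} = count_list b i" by simp
    qed
  qed
  then have "card {A. A \<subseteq> {..<k * n} \<and> (\<forall>i<k. card {x \<in> A. x div n = i} = count_list b i)} = card ?F"
    by (rule bij_betw_same_card)
  also have "\<dots> = (\<Prod>i<k. n choose count_list b i)"
    by (simp add: card_PiE n_subsets B)
  also have "{A. A \<subseteq> {..<k * n} \<and> (\<forall>i<k. card {x \<in> A. x div n = i} = count_list b i)} =
     {A. A \<subseteq> {..<k * n} \<and> map (\<lambda>x. x div n) (sorted_list_of_set A) = b}"
    using map_div_sorted_list_of_set_eq_iff[OF _ b] by blast
  finally show ?thesis .
qed

text \<open>Every occurrence has exactly one block sequence, so the favourable sets split disjointly
  over \<open>embeddings\<close>.\<close>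

lemma pattern_density_inflate:
  assumes t: "is_signed_perm t" and \<sigma>: "distinct \<sigma>" and n: "n > 0"
  shows "pattern_density \<sigma> (inflate t n) =
    real (\<Sum>b\<in>set (embeddings t \<sigma>). \<Prod>i<length t. n choose count_list b i) /
    real (length t * n choose length \<sigma>)"
proof -
  let ?k = "length t"
  let ?S = "\<lambda>b. {A. A \<subseteq> {..<?k * n} \<and> map (\<lambda>x. x div n) (sorted_list_of_set A) = b}"
  have len: "card A = length b" if "A \<in> ?S b" for A b
    using that by auto
  have "{A. A \<subseteq> {..<length (inflate t n)} \<and> card A = length \<sigma> \<and> occurs_at \<sigma> (inflate t n) A} =
     (\<Union>b\<in>set (embeddings t \<sigma>). ?S b)"
    using occurs_at_inflate_iff[OF t \<sigma>] len by (auto simp: set_embeddings)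
  moreover have "card (\<Union>b\<in>set (embeddings t \<sigma>). ?S b) = (\<Sum>b\<in>set (embeddings t \<sigma>). card (?S b))"
    by (rule card_UN_disjoint) (auto intro: finite_subset[OF _ finite_Pow_iff[THEN iffD2, OF finite_lessThan]])
  moreover have "card (?S b) = (\<Prod>i<?k. n choose count_list b i)" if "b \<in> set (embeddings t \<sigma>)" for b
  proof (rule card_subsets_with_blocks[OF n])
    show "sorted b" "set b \<subseteq> {..<?k}"
      using that by (auto simp: set_embeddings sorted_iff_nth_mono_less)
  qed
  ultimately show ?thesis
    by (simp add: pattern_density_def n_subsets)
qed

section \<open>Limit densities as integers over a power of the number of blocks\<close>

text \<open>Passing from \<open>c\<close> to \<open>Suc c\<close> multiplies the quotient by
  \<open>(1 - c/n) / Suc c\<close>.\<close>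

lemma tendsto_binomial_over_power:
  "(\<lambda>n. real (n choose c) / real n ^ c) \<longlonglongrightarrow> 1 / fact c"
proof (induction c)
  case 0
  then show ?case by simp
next
  case (Suc c)
  have "(\<lambda>n. 1 - real c * (1 / real n)) \<longlonglongrightarrow> 1 - real c * 0"
    by (intro tendsto_intros lim_1_over_n)
  then have "(\<lambda>n. real (n choose c) / real n ^ c * (1 - real c * (1 / real n)) / real (Suc c))
      \<longlonglongrightarrow> 1 / fact c * (1 - real c * 0) / real (Suc c)"
    by (intro tendsto_divide tendsto_mult Suc tendsto_const) auto
  also have "1 / fact c * (1 - real c * 0) / real (Suc c) = 1 / fact (Suc c)"
    by simp
  finally show ?case
  proof (rule Lim_transform_eventually)
    show "\<forall>\<^sub>F n in sequentially. real (n choose c) / real n ^ c * (1 - real c * (1 / real n)) / real (Suc c)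
       = real (n choose Suc c) / real n ^ Suc c"
      \<comment> \<open>This bound makes \<open>n\<close> nonzero and the subtraction
        \<open>n - c\<close> exact.\<close>
      using eventually_ge_at_top[of "Suc c"]
    proof eventually_elim
      case (elim n)
      have "Suc c * (n choose Suc c) = (n choose c) * (n - c)"
        by (metis binomial_absorption binomial_absorb_comp mult.commute)
      then have "real (Suc c) * real (n choose Suc c) = real (n choose c) * (real n - real c)"
        using elim by (metis Suc_leD of_nat_diff of_nat_mult)
      then have "real (n choose Suc c) = real (n choose c) * (real n - real c) / real (Suc c)"
        by (simp add: field_simps)
      moreover have "1 - real c * (1 / real n) = (real n - real c) / real n"
        using elim by (simp add: field_simps)
      ultimately show ?case by simp
    qed
  qed
qed

text \<open>The product of the factorials of the multiplicities, in a form that evaluates fast.\<close>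

fun repetition_factor :: "nat list \<Rightarrow> int" where
  "repetition_factor [] = 1"
| "repetition_factor (x # xs) = (1 + int (count_list xs x)) * repetition_factor xs"

lemma repetition_factor_eq:
  assumes "set b \<subseteq> {..<k}"
  shows "repetition_factor b = (\<Prod>i<k. fact (count_list b i))"
  using assms
proof (induction b)
  case (Cons x xs)
  \<comment> \<open>Prepending \<open>x\<close> raises its multiplicity by one, which multiplies the
    factorial by the new multiplicity.\<close>
  have "(\<Prod>i<k. fact (count_list (x # xs) i)) =
      (\<Prod>i<k. (if i = x then 1 + int (count_list xs x) else 1) * fact (count_list xs i))"
    by (rule prod.cong) auto
  also have "\<dots> = (1 + int (count_list xs x)) * (\<Prod>i<k. fact (count_list xs i))"
    using Cons.prems by (simp add: prod.distrib)
  finally show ?case using Cons by simp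
qed simp

text \<open>The quotient is a multinomial coefficient, the number of arrangements of a multiset.
  Hence the division in \<open>embedding_weight\<close> is exact.\<close>

lemma repetition_factor_dvd: "repetition_factor b dvd fact (length b)"
proof -
  obtain k where k: "set b \<subseteq> {..<k}"
    using finite_nat_set_iff_bounded[of "set b"] by auto
  \<comment> \<open>Indices absent from \<open>b\<close> contribute
    \<open>fact 0 = 1\<close>.\<close>
  have "(\<Prod>i<k. fact (count_list b i)) = (\<Prod>i\<in>set b. fact (count_list b i) :: nat)"
    by (rule prod.mono_neutral_right) (use k in auto)
  then have "(\<Prod>i<k. fact (count_list b i)) dvd (fact (length b) :: nat)"
    using card_permutations_of_multiset_aux[of "mset b"] by (metis (no_types, lifting) count_mset dvd_triv_right prod.cong set_mset_mset size_mset)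
  then have "int (\<Prod>i<k. fact (count_list b i)) dvd int (fact (length b))"
    by (simp only: of_nat_dvd_iff)
  then show ?thesis by (simp add: repetition_factor_eq[OF k])
qed

text \<open>The integer N of the limit N / k^m. A block sequence is weighted by the number of its
  rearrangements, so N counts the words of length m over the blocks whose sorted form is an
  embedding.\<close>

definition embedding_weight :: "int list \<Rightarrow> nat list \<Rightarrow> int" where
  "embedding_weight t \<sigma> =
     (\<Sum>m\<leftarrow>map repetition_factor (embeddings t \<sigma>). fact (length \<sigma>) div m)"

text \<open>The limit density is 1/m!, with denominators cleared so that integer evaluation decides
  it.\<close>

definition balanced :: "int list \<Rightarrow> nat list \<Rightarrow> bool" where
  "balanced t \<sigma> \<longleftrightarrow> fact (length \<sigma>) * embedding_weight t \<sigma> = int (length t) ^ length \<sigma>"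

lemma of_int_embedding_weight:
  "real_of_int (embedding_weight t \<sigma>) =
     (\<Sum>b\<in>set (embeddings t \<sigma>). fact (length \<sigma>) * (\<Prod>i<length t. 1 / fact (count_list b i)))"
proof -
  have "real_of_int (embedding_weight t \<sigma>) =
      (\<Sum>b\<in>set (embeddings t \<sigma>). real_of_int (fact (length \<sigma>) div repetition_factor b))"
    by (simp add: embedding_weight_def comp_def sum_list_distinct_conv_sum_set distinct_embeddings)
  also have "\<dots> = (\<Sum>b\<in>set (embeddings t \<sigma>). fact (length \<sigma>) * (\<Prod>i<length t. 1 / fact (count_list b i)))"
  proof (rule sum.cong)
    fix b assume "b \<in> set (embeddings t \<sigma>)"
    then have "length b = length \<sigma>" and b: "set b \<subseteq> {..<length t}" by (auto simp: set_embeddings)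
    then have "repetition_factor b dvd fact (length \<sigma>)"
      using repetition_factor_dvd[of b] by simp
    then have "real_of_int (fact (length \<sigma>) div repetition_factor b) =
        fact (length \<sigma>) / real_of_int (repetition_factor b)"
      by (simp add: real_of_int_div)
    then show "real_of_int (fact (length \<sigma>) div repetition_factor b) =
        fact (length \<sigma>) * (\<Prod>i<length t. 1 / fact (count_list b i))"
      by (simp add: repetition_factor_eq[OF b] prod_dividef)
  qed simp
  finally show ?thesis .
qed

text \<open>Numerator and denominator of the exact density are divided by n^m, after which
  \<open>tendsto_binomial_over_power\<close> applies to each binomial coefficient.\<close>

lemma tendsto_pattern_density_inflate:
  assumes t: "is_signed_perm t" "t \<noteq> []" and \<sigma>: "distinct \<sigma>"
  shows "(\<lambda>n. pattern_density \<sigma> (inflate t n)) \<longlonglongrightarrow>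
    real_of_int (embedding_weight t \<sigma>) / real (length t) ^ length \<sigma>"
proof -
  let ?k = "length t" and ?m = "length \<sigma>" and ?E = "set (embeddings t \<sigma>)"
  have k: "?k > 0" using t by simp
  have E: "length b = ?m" "set b \<subseteq> {..<?k}" if "b \<in> ?E" for b
    using that by (auto simp: set_embeddings)
  have num: "(\<lambda>n. (\<Sum>b\<in>?E. \<Prod>i<?k. real (n choose count_list b i) / real n ^ count_list b i))
      \<longlonglongrightarrow> (\<Sum>b\<in>?E. \<Prod>i<?k. 1 / fact (count_list b i))"
    by (intro tendsto_sum tendsto_prod tendsto_binomial_over_power)
  have den: "(\<lambda>n. real (n * ?k choose ?m) / real (n * ?k) ^ ?m) \<longlonglongrightarrow> 1 / fact ?m"
    by (rule filterlim_compose[OF tendsto_binomial_over_power])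
       (use k in \<open>auto intro: filterlim_subseq simp: strict_mono_def\<close>)
  \<comment> \<open>The factor \<open>real ?k ^ ?m\<close> turns the division of the denominator by
    (n k)^m into one by n^m, matching the numerator.\<close>
  have "(\<lambda>n. (\<Sum>b\<in>?E. \<Prod>i<?k. real (n choose count_list b i) / real n ^ count_list b i) /
        ((real (n * ?k choose ?m) / real (n * ?k) ^ ?m) * real ?k ^ ?m))
      \<longlonglongrightarrow> (\<Sum>b\<in>?E. \<Prod>i<?k. 1 / fact (count_list b i)) / (1 / fact ?m * real ?k ^ ?m)"
    by (intro tendsto_divide tendsto_mult num den tendsto_const) (use k in auto)
  also have "(\<Sum>b\<in>?E. \<Prod>i<?k. 1 / fact (count_list b i)) / (1 / fact ?m * real ?k ^ ?m) =
      (\<Sum>b\<in>?E. fact ?m * (\<Prod>i<?k. 1 / fact (count_list b i))) / real ?k ^ ?m"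
    by (simp add: sum_distrib_left[symmetric])
  also have "(\<Sum>b\<in>?E. fact ?m * (\<Prod>i<?k. 1 / fact (count_list b i))) = real_of_int (embedding_weight t \<sigma>)"
    by (rule of_int_embedding_weight[symmetric])
  finally show ?thesis
  proof (rule Lim_transform_eventually)
    show "\<forall>\<^sub>F n in sequentially.
        (\<Sum>b\<in>?E. \<Prod>i<?k. real (n choose count_list b i) / real n ^ count_list b i) /
        ((real (n * ?k choose ?m) / real (n * ?k) ^ ?m) * real ?k ^ ?m)
        = pattern_density \<sigma> (inflate t n)"
      using eventually_gt_at_top[of 0]
    proof eventually_elim
      case (elim n)
      \<comment> \<open>The multiplicities in \<open>b\<close> add up to the pattern length.\<close>
      have "(\<Prod>i<?k. real n ^ count_list b i) = real n ^ ?m" if "b \<in> ?E" for b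
        using E[OF that] by (simp add: power_sum[symmetric] sum_count_set)
      then have "(\<Sum>b\<in>?E. \<Prod>i<?k. real (n choose count_list b i) / real n ^ count_list b i) =
          (\<Sum>b\<in>?E. \<Prod>i<?k. real (n choose count_list b i)) / real n ^ ?m"
        by (simp add: prod_dividef sum_divide_distrib)
      then show ?case
        using elim k by (simp add: pattern_density_inflate[OF t(1) \<sigma>] power_mult_distrib mult.commute)
    qed
  qed
qed

text \<open>The inflations of \<open>t\<close> are the counterexample: their sizes tend to infinity,
  the patterns in \<open>S\<close> have the required limits, and uniqueness of limits rules this out
  for \<sigma>.\<close>

lemma not_quasirandom_forcing_if_balanced:
  assumes t: "is_signed_perm t" "t \<noteq> []"
    and S: "\<And>\<sigma>. \<sigma> \<in> S \<Longrightarrow> is_perm \<sigma> \<and> balanced t \<sigma>"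
    and \<sigma>: "is_perm \<sigma>" "\<not> balanced t \<sigma>"
  shows "\<not> quasirandom_forcing S"
proof
  assume forcing: "quasirandom_forcing S"
  have k: "length t > 0" using t by simp
  have eq: "real_of_int (embedding_weight t \<rho>) / real (length t) ^ length \<rho> = 1 / fact (length \<rho>) \<longleftrightarrow>
      balanced t \<rho>" for \<rho>
  proof -
    have "balanced t \<rho> \<longleftrightarrow> real_of_int (fact (length \<rho>) * embedding_weight t \<rho>) =
        real_of_int (int (length t) ^ length \<rho>)"
      unfolding balanced_def by (simp only: of_int_eq_iff)
    then show ?thesis using k by (auto simp: field_simps)
  qed
  have lim: "(\<lambda>n. pattern_density \<rho> (inflate t n)) \<longlonglongrightarrow>
      real_of_int (embedding_weight t \<rho>) / real (length t) ^ length \<rho>" if "is_perm \<rho>" for \<rho>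
    using that by (intro tendsto_pattern_density_inflate t) (simp add: is_perm_def permutations_of_set_def)
  have "filterlim (\<lambda>n. length (inflate t n)) at_top sequentially"
    using k by (auto intro: filterlim_subseq simp: strict_mono_def)
  moreover have "(\<lambda>n. pattern_density \<rho> (inflate t n)) \<longlonglongrightarrow> 1 / fact (length \<rho>)" if "\<rho> \<in> S" for \<rho>
    using lim[of \<rho>] S[OF that] eq[of \<rho>] by metis
  ultimately have "(\<lambda>n. pattern_density \<sigma> (inflate t n)) \<longlonglongrightarrow> 1 / fact (length \<sigma>)"
    using forcing is_perm_inflate[OF t(1)] \<sigma>(1) unfolding quasirandom_forcing_def by blast
  then have "real_of_int (embedding_weight t \<sigma>) / real (length t) ^ length \<sigma> = 1 / fact (length \<sigma>)"
    using lim[OF \<sigma>(1)] LIMSEQ_unique by blast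
  with eq \<sigma>(2) show False by blast
qed

section \<open>From the all-one matrix to Latin squares\<close>

text \<open>For permutations: their matrices have no common 1, as for two rows of a Latin
  square.\<close>

definition disagree :: "'a list \<Rightarrow> 'a list \<Rightarrow> bool" where
  "disagree = list_all2 (\<noteq>)"

text \<open>A common value would produce an entry of at least 2 in the sum, since the rest
  \<open>R\<close> is nonnegative.\<close>

lemma disagree_if_perm_matrix_sum:
  assumes len: "length p = 4" "length q = 4"
    and p: "p \<in> permutations_of_set {1..4}"
    and sum: "perm_matrix p + perm_matrix q + R = mat 4 4 (\<lambda>_. 1)"
    and R: "R \<in> carrier_mat 4 4" "\<And>i j. i < 4 \<Longrightarrow> j < 4 \<Longrightarrow> 0 \<le> R $$ (i, j)"
  shows "disagree p q"
proof -
  have "p ! i \<noteq> q ! i" if i: "i < 4" for i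
  proof
    assume eq: "p ! i = q ! i"
    have "p ! i \<in> {1..4}"
      using p i len nth_mem[of i p] by (simp add: permutations_of_set_def)
    \<comment> \<open>Values are 1-based and columns 0-based.\<close>
    then obtain j where j: "j < 4" "p ! i = j + 1"
      by (metis Suc_eq_plus1 Suc_le_eq atLeastAtMost_iff le_add_diff_inverse2)
    have "(perm_matrix p + perm_matrix q + R) $$ (i, j) = 2 + R $$ (i, j)"
      using i j len R(1) eq by (simp add: perm_matrix_def)
    then show False using R(2)[OF i j(1)] i j(1) by (simp add: sum)
  qed
  then show ?thesis
    using len by (simp add: disagree_def list_all2_conv_all_nth)
qed

text \<open>For each pair the sum is regrouped so that the other two matrices form the nonnegative
  rest.\<close>

lemma disagree_if_perm_matrix_sum4:
  assumes "\<pi>1 \<in> permutations_of_set {1..4}" and "\<pi>2 \<in> permutations_of_set {1..4}"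
    and "\<pi>3 \<in> permutations_of_set {1..4}" and "\<pi>4 \<in> permutations_of_set {1..4}"
    and sum: "perm_matrix \<pi>1 + perm_matrix \<pi>2 + perm_matrix \<pi>3 + perm_matrix \<pi>4 = mat 4 4 (\<lambda>_. 1)"
  shows "disagree \<pi>1 \<pi>2"
    and "disagree \<pi>1 \<pi>3" "disagree \<pi>2 \<pi>3"
    and "disagree \<pi>1 \<pi>4" "disagree \<pi>2 \<pi>4" "disagree \<pi>3 \<pi>4"
proof -
  have len: "length \<pi>1 = 4" "length \<pi>2 = 4" "length \<pi>3 = 4" "length \<pi>4 = 4"
    using assms(1-4) by (auto dest: length_finite_permutations_of_set)
  have M: "perm_matrix \<pi> \<in> carrier_mat 4 4" if "length \<pi> = 4" for \<pi>
    using that by (simp add: perm_matrix_def)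
  note M = M[OF len(1)] M[OF len(2)] M[OF len(3)] M[OF len(4)]
  have disagree: "disagree p q"
    if "perm_matrix p + perm_matrix q + (perm_matrix r + perm_matrix s) = mat 4 4 (\<lambda>_. 1)"
      "length p = 4" "length q = 4" "length r = 4" "length s = 4" "p \<in> permutations_of_set {1..4}"
    for p q r s
    using that by (intro disagree_if_perm_matrix_sum[OF that(2,3,6,1)]) (auto simp: perm_matrix_def)
  have *: "mat 4 4 (\<lambda>_. 1) = perm_matrix \<pi>1 + perm_matrix \<pi>2 + perm_matrix \<pi>3 + perm_matrix \<pi>4"
    using sum by simp
  show "disagree \<pi>1 \<pi>2"
    by (rule disagree[of _ _ \<pi>3 \<pi>4]) (use assms M len in \<open>auto simp: * intro!: eq_matI\<close>)
  show "disagree \<pi>1 \<pi>3"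
    by (rule disagree[of _ _ \<pi>2 \<pi>4]) (use assms M len in \<open>auto simp: * intro!: eq_matI\<close>)
  show "disagree \<pi>2 \<pi>3"
    by (rule disagree[of _ _ \<pi>1 \<pi>4]) (use assms M len in \<open>auto simp: * intro!: eq_matI\<close>)
  show "disagree \<pi>1 \<pi>4"
    by (rule disagree[of _ _ \<pi>2 \<pi>3]) (use assms M len in \<open>auto simp: * intro!: eq_matI\<close>)
  show "disagree \<pi>2 \<pi>4"
    by (rule disagree[of _ _ \<pi>1 \<pi>3]) (use assms M len in \<open>auto simp: * intro!: eq_matI\<close>)
  show "disagree \<pi>3 \<pi>4"
    by (rule disagree[of _ _ \<pi>1 \<pi>2]) (use assms M len in \<open>auto simp: * intro!: eq_matI\<close>)
qed

section \<open>Verification of the witnesses and exhaustion of the Latin squares\<close>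

text \<open>The second components were found by simulated annealing.\<close>

definition witnesses :: "(nat list list \<times> int list) list" where
  "witnesses =
  [([[1,2,3,4], [2,1,4,3], [3,4,2,1], [4,3,1,2]],
    [-9,-3,11,10,-1,4,-7,-6,-5,-8,-12,2]),
   ([[1,2,3,4], [2,3,4,1], [3,4,1,2], [4,1,2,3]],
    [4,-2,12,1,9,10,-11,-8,5,6,-7,3]),
   ([[1,2,3,4], [2,4,1,3], [3,1,4,2], [4,3,2,1]],
    [-8,3,2,-10,-12,11,1,-4,-9,6,-5,7]),
   ([[1,2,4,3], [2,1,3,4], [3,4,1,2], [4,3,2,1]],
    [-2,12,8,5,6,7,-4,1,-10,-11,3,9]),
   ([[1,2,4,3], [2,1,3,4], [3,4,2,1], [4,3,1,2]],
    [4,12,3,9,2,8,1,11,7,10,6,5]),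
   ([[1,2,4,3], [2,3,1,4], [3,4,2,1], [4,1,3,2]],
    [1,10,11,8,4,2,7,9,3,6,5,12]),
   ([[1,2,4,3], [2,4,3,1], [3,1,2,4], [4,3,1,2]],
    [1,6,9,5,11,10,7,4,8,2,3,12]),
   ([[1,3,2,4], [2,1,4,3], [3,4,1,2], [4,2,3,1]],
    [1,7,5,12,4,6,10,3,11,9,2,8]),
   ([[1,3,2,4], [2,4,1,3], [3,2,4,1], [4,1,3,2]],
    [-7,-10,-1,-5,9,12,-4,8,-2,3,-6,11]),
   ([[1,3,2,4], [2,4,3,1], [3,1,4,2], [4,2,1,3]],
    [-4,10,-9,6,-2,-5,1,-12,-7,-8,3,11]),
   ([[1,3,4,2], [2,1,3,4], [3,4,2,1], [4,2,1,3]],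
    [1,10,11,5,9,6,3,2,8,4,7,12]),
   ([[1,3,4,2], [2,4,1,3], [3,1,2,4], [4,2,3,1]],
    [3,9,6,7,12,4,1,11,5,8,10,2]),
   ([[1,3,4,2], [2,4,3,1], [3,1,2,4], [4,2,1,3]],
    [2,10,4,12,8,7,6,5,1,9,3,11]),
   ([[1,3,4,2], [2,4,3,1], [3,2,1,4], [4,1,2,3]],
    [6,5,4,11,2,3,7,10,12,8,9,1]),
   ([[1,4,2,3], [2,1,3,4], [3,2,4,1], [4,3,1,2]],
    [1,8,7,10,4,6,11,9,5,2,3,12]),
   ([[1,4,2,3], [2,3,1,4], [3,1,4,2], [4,2,3,1]],
    [6,10,2,5,8,12,3,11,7,1,9,4]),
   ([[1,4,2,3], [2,3,1,4], [3,2,4,1], [4,1,3,2]],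
    [9,1,11,3,8,7,6,5,10,2,12,4]),
   ([[1,4,2,3], [2,3,4,1], [3,2,1,4], [4,1,3,2]],
    [12,5,6,3,2,1,7,10,11,8,4,9]),
   ([[1,4,3,2], [2,1,4,3], [3,2,1,4], [4,3,2,1]],
    [-9,11,-1,-12,-4,-3,2,5,-8,-7,6,-10]),
   ([[1,4,3,2], [2,3,1,4], [3,2,4,1], [4,1,2,3]],
    [4,9,5,2,3,6,12,11,10,7,8,1]),
   ([[1,4,3,2], [2,3,4,1], [3,1,2,4], [4,2,1,3]],
    [12,4,5,1,3,6,10,11,2,9,8,7]),
   ([[1,4,3,2], [2,3,4,1], [3,2,1,4], [4,1,2,3]],
    [-11,-9,6,-8,3,1,12,10,-5,7,-4,-2])]"

text \<open>The executable hypotheses of \<open>not_quasirandom_forcing_if_balanced\<close>, with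
  123 as the pattern of wrong density.\<close>

fun is_witness :: "nat list list \<times> int list \<Rightarrow> bool" where
  "is_witness (Q, t) \<longleftrightarrow>
     t \<noteq> [] \<and> is_signed_perm t \<and> list_all (balanced t) Q \<and> \<not> balanced t [1, 2, 3]"

text \<open>Evaluated by rewriting with code equations, hence checked by the kernel.\<close>

lemma is_witness_witnesses: "list_all is_witness witnesses"
  by code_simp

text \<open>Backtracking search: once \<open>p\<close> is chosen, only lists that disagree with it
  remain candidates.\<close>

fun transversals :: "nat \<Rightarrow> 'a list list \<Rightarrow> 'a list list list" where
  "transversals 0 L = [[]]"
| "transversals (Suc n) L = [p # Q. p \<leftarrow> L, Q \<leftarrow> transversals n (filter (disagree p) L)]"

text \<open>\<open>sorted_wrt\<close> expresses a pairwise relation here; no ordering is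
  involved.\<close>

lemma set_transversals:
  "Q \<in> set (transversals n L) \<longleftrightarrow> length Q = n \<and> set Q \<subseteq> set L \<and> sorted_wrt disagree Q"
proof (induction n arbitrary: Q L)
  case (Suc n)
  have "Q \<in> set (transversals (Suc n) L) \<longleftrightarrow>
      (\<exists>p\<in>set L. \<exists>Q'. Q = p # Q' \<and> Q' \<in> set (transversals n (filter (disagree p) L)))"
    by auto
  also have "\<dots> \<longleftrightarrow> length Q = Suc n \<and> set Q \<subseteq> set L \<and> sorted_wrt disagree Q"
    unfolding Suc.IH by (cases Q) auto
  finally show ?case .
qed auto

text \<open>Membership in \<open>R\<close> in any order suffices, since balance is a property of
  each pattern separately.\<close>

definition covered :: "nat list list \<Rightarrow> bool" where
  "covered Q \<longleftrightarrow> list_ex (\<lambda>(R, t). list_all (\<lambda>p. p \<in> set R) Q) witnesses \<or>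
     set Q = {[1,2,3,4], [2,1,4,3], [3,4,1,2], [4,3,2,1]} \<or>
     set Q = {[1,3,2,4], [2,4,1,3], [3,1,4,2], [4,2,3,1]}"

text \<open>The quadruples are ordered, so evaluation runs through all 576 Latin squares of order
  4.\<close>

lemma covered_transversals: "list_all covered (transversals 4 (permutations_of_set_list [1,2,3,4]))"
  by code_simp

theorem theorem13:
  fixes \<pi>1 \<pi>2 \<pi>3 \<pi>4 :: "nat list"
  assumes "\<pi>1 \<in> permutations_of_set {1..4}" and "\<pi>2 \<in> permutations_of_set {1..4}"
    and "\<pi>3 \<in> permutations_of_set {1..4}" and "\<pi>4 \<in> permutations_of_set {1..4}"
    and "perm_matrix \<pi>1 + perm_matrix \<pi>2 + perm_matrix \<pi>3 + perm_matrix \<pi>4 = mat 4 4 (\<lambda>_. 1)"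
    and "{\<pi>1, \<pi>2, \<pi>3, \<pi>4} \<noteq> {[1,2,3,4], [2,1,4,3], [3,4,1,2], [4,3,2,1]}"
    and "{\<pi>1, \<pi>2, \<pi>3, \<pi>4} \<noteq> {[1,3,2,4], [2,4,1,3], [3,1,4,2], [4,2,3,1]}"
  shows "\<not> quasirandom_forcing {\<pi>1, \<pi>2, \<pi>3, \<pi>4}"
proof -
  let ?Q = "[\<pi>1, \<pi>2, \<pi>3, \<pi>4]" and ?L = "permutations_of_set_list [1,2,3,4::nat]"
  \<comment> \<open>The interval becomes an explicit list to match the executable
    enumeration.\<close>
  have "{1..4} = set [1,2,3,4::nat]" by auto
  then have "permutations_of_set {1..4::nat} = set ?L"
    using permutations_of_list[of "[1,2,3,4::nat]"] by simp
  then have "?Q \<in> set (transversals 4 ?L)"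
    using assms(1-4) disagree_if_perm_matrix_sum4[OF assms(1-5)]
    unfolding set_transversals by simp
  then have "covered ?Q"
    using covered_transversals unfolding list_all_iff by blast
  \<comment> \<open>The two excluded quadruples are the only alternatives in \<open>covered\<close>
    to a witness.\<close>
  with assms(6,7) obtain R t where R: "(R, t) \<in> set witnesses" "set ?Q \<subseteq> set R"
    unfolding covered_def by (auto simp: list_ex_iff)
  have w: "is_witness (R, t)"
    using is_witness_witnesses R(1) unfolding list_all_iff by blast
  show ?thesis
  proof (rule not_quasirandom_forcing_if_balanced)
    show "is_signed_perm t" "t \<noteq> []" "\<not> balanced t [1, 2, 3]"
      using w unfolding is_witness.simps by blast+
    show "is_perm [1, 2, 3]" by (auto simp: is_perm_def permutations_of_set_def)
    fix \<sigma> assume \<sigma>: "\<sigma> \<in> {\<pi>1, \<pi>2, \<pi>3, \<pi>4}"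
    then have "\<sigma> \<in> permutations_of_set {1..4}" using assms(1-4) by auto
    moreover from this have "length \<sigma> = 4" by (auto dest: length_finite_permutations_of_set)
    ultimately have "is_perm \<sigma>" by (simp add: is_perm_def)
    moreover have "balanced t \<sigma>" using w R(2) \<sigma> by (auto simp: list_all_iff)
    ultimately show "is_perm \<sigma> \<and> balanced t \<sigma>" by simp
  qed
qed

end
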